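(* Let $G=(V,E)$ be a connected finite undirected graph with positive edge weights. Let $\mu$ be the smallest nonzero real number which is an eigenvalue of problem (P) admitting a nonconstant eigenvector, and let $\vec x$ be a nonconstant eigenvector of (P) with eigenvalue $\mu$. Then $\{i\in V: x_i\neq 0\}$ is a vertex cover of $G$, i.e. every edge of $G$ has at least one endpoint $i$ with $x_i\neq 0$.
   Context: $V=\{1,\dots,n\}$, edge weights $w_{ij}=w_{ji}>0$; $d_i=\sum_{j:\{i,j\}\in E}w_{ij}$; $\mathrm{vol}(S)=\sum_{i\in S}d_i$. $I^+(\vec x)=\sum_{\{i,j\}\in E}w_{ij}|x_i+x_j|$, $\Delta_1^+\vec x=\partial I^+(\vec x)$ (convex subdifferential), $N(\vec x)=\min_{t\in\mathbb{R}}\sum_i d_i|x_i-t|$. Problem (P): $(\lambda,\vec x)$, $\lambda\in\mathbb{R}$, $\vec x\neq\vec0$, with $\vec 0\in \mathrm{vol}(V)\,\partial\|\vec x\|_\infty-\Delta_1^+\vec x-\lambda\,\partial N(\vec x)$. *)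

theory Defs
  imports "HOL-Analysis.Analysis"
begin

text \<open>
  The vertex set is the universe of a finite type \<open>'n\<close>; vectors indexed by vertices live in
  \<open>real ^ 'n\<close>.  An edge is a two-element set of vertices, and the values of the weight function
  outside the edge set play no role.
\<close>

definition weighted_graph :: "'n::finite set set \<Rightarrow> ('n \<Rightarrow> 'n \<Rightarrow> real) \<Rightarrow> bool" where
  "weighted_graph E w \<longleftrightarrow>
     (\<forall>e\<in>E. card e = 2) \<and> (\<forall>i j. {i, j} \<in> E \<longrightarrow> w i j = w j i \<and> w i j > 0)"

definition connected_graph :: "'n set set \<Rightarrow> bool" where
  "connected_graph E \<longleftrightarrow> (\<forall>u v. (u, v) \<in> {(i, j). {i, j} \<in> E}\<^sup>*)"

definition vertex_cover :: "'n set set \<Rightarrow> 'n set \<Rightarrow> bool" where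
  "vertex_cover E S \<longleftrightarrow> (\<forall>e\<in>E. \<exists>i\<in>e. i \<in> S)"

definition degree :: "'n::finite set set \<Rightarrow> ('n \<Rightarrow> 'n \<Rightarrow> real) \<Rightarrow> 'n \<Rightarrow> real" where
  "degree E w i = (\<Sum>j | {i, j} \<in> E. w i j)"

definition vol :: "'n::finite set set \<Rightarrow> ('n \<Rightarrow> 'n \<Rightarrow> real) \<Rightarrow> 'n set \<Rightarrow> real" where
  "vol E w S = (\<Sum>i\<in>S. degree E w i)"

text \<open>Each edge occurs as two ordered pairs in the sum, whence the division by 2.\<close>

definition I_plus :: "'n::finite set set \<Rightarrow> ('n \<Rightarrow> 'n \<Rightarrow> real) \<Rightarrow> real ^ 'n \<Rightarrow> real" where
  "I_plus E w x = (\<Sum>(i, j)\<in>{(i, j). {i, j} \<in> E}. w i j * \<bar>x $ i + x $ j\<bar>) / 2"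

text \<open>The infimum is a minimum for positive weights; see \<open>N_attained\<close> below.\<close>

definition N :: "'n::finite set set \<Rightarrow> ('n \<Rightarrow> 'n \<Rightarrow> real) \<Rightarrow> real ^ 'n \<Rightarrow> real" where
  "N E w x = (INF t. \<Sum>i\<in>UNIV. degree E w i * \<bar>x $ i - t\<bar>)"

definition subdifferential :: "('a::real_inner \<Rightarrow> real) \<Rightarrow> 'a \<Rightarrow> 'a set" where
  "subdifferential f x = {u. \<forall>y. f y \<ge> f x + u \<bullet> (y - x)}"

definition Delta1_plus :: "'n::finite set set \<Rightarrow> ('n \<Rightarrow> 'n \<Rightarrow> real) \<Rightarrow> real ^ 'n \<Rightarrow> (real ^ 'n) set" where
  "Delta1_plus E w x = subdifferential (I_plus E w) x"

text \<open>
  The set below is the Minkowski combination of the three sets of subgradients; \<open>infnorm\<close> is the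
  maximum norm on \<open>real ^ 'n\<close>.
\<close>

definition eigenpair ::
    "'n::finite set set \<Rightarrow> ('n \<Rightarrow> 'n \<Rightarrow> real) \<Rightarrow> real \<Rightarrow> real ^ 'n \<Rightarrow> bool" where
  "eigenpair E w l x \<longleftrightarrow> x \<noteq> 0 \<and>
     0 \<in> {vol E w UNIV *\<^sub>R u - v - l *\<^sub>R z | u v z.
            u \<in> subdifferential infnorm x \<and> v \<in> Delta1_plus E w x \<and>
            z \<in> subdifferential (N E w) x}"

definition nonconstant :: "real ^ 'n \<Rightarrow> bool" where
  "nonconstant x \<longleftrightarrow> \<not> (\<exists>c. \<forall>i. x $ i = c)"

definition nonzero_nonconst_eigenvalues ::
    "'n::finite set set \<Rightarrow> ('n \<Rightarrow> 'n \<Rightarrow> real) \<Rightarrow> real set" where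
  "nonzero_nonconst_eigenvalues E w =
     {l. l \<noteq> 0 \<and> (\<exists>x. eigenpair E w l x \<and> nonconstant x)}"

lemma N_attained:
  fixes x :: "real ^ 'n"
  assumes "weighted_graph E w"
  shows "\<exists>t. N E w x = (\<Sum>i\<in>UNIV. degree E w i * \<bar>x $ i - t\<bar>)
           \<and> (\<forall>s. N E w x \<le> (\<Sum>i\<in>UNIV. degree E w i * \<bar>x $ i - s\<bar>))"
proof -
  define f where "f t = (\<Sum>i\<in>UNIV. degree E w i * \<bar>x $ i - t\<bar>)" for t
  define M where "M = infnorm x"
  have M: "\<bar>x $ i\<bar> \<le> M" for i
    unfolding M_def by (rule component_le_infnorm_cart)
  have M0: "0 \<le> M" unfolding M_def by (rule infnorm_pos_le)
  have d: "degree E w i \<ge> 0" for i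
    using assms unfolding degree_def weighted_graph_def by (intro sum_nonneg) (metis less_imp_le mem_Collect_eq)
  have "continuous_on {-M..M} f" unfolding f_def by (intro continuous_intros)
  then obtain t where t: "t \<in> {-M..M}" "\<And>s. s \<in> {-M..M} \<Longrightarrow> f t \<le> f s"
    using continuous_attains_inf[of "{-M..M}" f] M0 by auto
  have le: "f t \<le> f s" for s
  proof -
    define c where "c = max (-M) (min M s)"
    have "f t \<le> f c" using t(2)[of c] M0 by (auto simp: c_def)
    also have "f c \<le> f s" unfolding f_def
    proof (intro sum_mono mult_left_mono d)
      fix i show "\<bar>x $ i - c\<bar> \<le> \<bar>x $ i - s\<bar>" using M[of i] by (auto simp: c_def max_def min_def abs_if split: if_splits)
    qed
    finally show ?thesis .
  qed
  have "(INF t. f t) = f t" by (intro cInf_eq_minimum) (auto intro: le)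
  then show ?thesis using le unfolding N_def f_def by auto
qed

end

theory Submission
  imports Defs
begin

text \<open>
  Write \<open>I(x)\<close> for the total variation, the sum of \<open>w\<^sub>i\<^sub>j\<bar>x\<^sub>i - x\<^sub>j\<bar>\<close> over the edges. Since
  \<open>\<bar>a + b\<bar> + \<bar>a - b\<bar> = 2 max \<bar>a\<bar> \<bar>b\<bar>\<close>, one has \<open>vol(V)\<parallel>x\<parallel>\<^sub>\<infinity> - I\<^sup>+(x) \<ge> I(x)\<close>, with equality only if
  every edge has an endpoint where \<open>\<bar>x\<^sub>i\<bar> = \<parallel>x\<parallel>\<^sub>\<infinity>\<close>. Euler's identity for the subgradients of
  homogeneous functions turns the eigenvalue equation into \<open>vol(V)\<parallel>x\<parallel>\<^sub>\<infinity> - I\<^sup>+(x) = \<mu> N(x)\<close>. It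
  remains to see that \<open>\<mu> N(x) \<le> I(x)\<close>. Let \<open>h\<close> be the minimum of \<open>I/N\<close> over the nonconstant
  vectors with entries \<open>\<plusminus>1\<close> (the Cheeger constant). Peeling off level sets shows \<open>h N \<le> I\<close>
  everywhere. Hence \<open>I\<^sup>+ + h N \<le> vol(V)\<parallel>\<cdot>\<parallel>\<^sub>\<infinity>\<close>, with equality at the minimising sign vector, so
  that vector is an eigenvector for \<open>h\<close>, and \<open>\<mu> \<le> h\<close>.
\<close>

section \<open>Total variation, sign vectors and Euler's identity\<close>

definition total_variation :: "'n::finite set set \<Rightarrow> ('n \<Rightarrow> 'n \<Rightarrow> real) \<Rightarrow> real ^ 'n \<Rightarrow> real" where
  "total_variation E w x = (\<Sum>(i, j)\<in>{(i, j). {i, j} \<in> E}. w i j * \<bar>x $ i - x $ j\<bar>) / 2"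

definition sign_vec :: "'n::finite set \<Rightarrow> real ^ 'n" where
  "sign_vec A = (\<chi> i. if i \<in> A then 1 else - 1)"

lemma sign_vec_nth [simp]: "sign_vec A $ i = (if i \<in> A then 1 else - 1)"
  by (simp add: sign_vec_def)

lemma nonconstant_sign_vec:
  assumes "A \<noteq> {}" "A \<noteq> UNIV"
  shows "nonconstant (sign_vec A)"
proof -
  obtain i j where "i \<in> A" "j \<notin> A" using assms by blast
  then have "sign_vec A $ i \<noteq> sign_vec A $ j" by simp
  then show ?thesis unfolding nonconstant_def by metis
qed

lemma infnorm_sign_vec: "infnorm (sign_vec A) = 1"
proof -
  have "range (\<lambda>i. \<bar>sign_vec A $ i\<bar>) = {1}" by auto
  then show ?thesis by (simp add: infnorm_cart full_SetCompr_eq)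
qed

text \<open>Testing the subgradient inequality at \<open>0\<close> and at twice \<open>x\<close>
  bounds \<open>u \<bullet> x\<close> from both sides. This is Euler's identity, with homogeneity
  used only at these two points.\<close>

lemma subdifferential_inner_eq:
  assumes "u \<in> subdifferential f x" "f 0 = 0" "f (2 *\<^sub>R x) \<le> 2 * f x"
  shows "u \<bullet> x = f x"
proof -
  have sub: "f y \<ge> f x + u \<bullet> (y - x)" for y
    using assms(1) by (auto simp: subdifferential_def)
  have "f (2 *\<^sub>R x) \<ge> f x + u \<bullet> x" using sub[of "2 *\<^sub>R x"] by (simp add: scaleR_2)
  moreover have "u \<bullet> x \<ge> f x" using sub[of 0] assms(2) by simp
  ultimately show ?thesis using assms(3) by linarith
qed

context
  fixes E :: "'n::finite set set" and w :: "'n \<Rightarrow> 'n \<Rightarrow> real"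
  assumes wg: "weighted_graph E w"
begin

section \<open>Edge sums and the gap between \<open>I_plus\<close> and the maximum norm\<close>

lemma weight_pos: "{i, j} \<in> E \<Longrightarrow> w i j > 0"
  using wg by (auto simp: weighted_graph_def)

lemma weight_sym: "{i, j} \<in> E \<Longrightarrow> w i j = w j i"
  using wg by (auto simp: weighted_graph_def)

lemma degree_nonneg: "degree E w i \<ge> 0"
  unfolding degree_def by (intro sum_nonneg) (auto intro: less_imp_le weight_pos)

lemma sum_over_edges:
  "(\<Sum>(i, j)\<in>{(i, j). {i, j} \<in> E}. f i j) = (\<Sum>i\<in>UNIV. \<Sum>j | {i, j} \<in> E. f i j)"
proof -
  have "{(i, j). {i, j} \<in> E} = (SIGMA i:UNIV. {j. {i, j} \<in> E})" by auto
  then show ?thesis by (simp add: sum.Sigma)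
qed

lemma vol_eq_sum_edges: "vol E w UNIV = (\<Sum>(i, j)\<in>{(i, j). {i, j} \<in> E}. w i j)"
  by (simp add: sum_over_edges vol_def degree_def)

text \<open>Since \<open>vol\<close> is the weight sum over ordered edges, the gap splits into one
  term per ordered edge. This form lets equality be read off edge by edge.\<close>

lemma infnorm_minus_I_plus_minus_total_variation:
  "vol E w UNIV * infnorm x - I_plus E w x - total_variation E w x =
    (\<Sum>(i, j)\<in>{(i, j). {i, j} \<in> E}.
      w i j * (2 * infnorm x - \<bar>x $ i + x $ j\<bar> - \<bar>x $ i - x $ j\<bar>)) / 2"
proof -
  have "(\<Sum>(i, j)\<in>{(i, j). {i, j} \<in> E}.
      w i j * (2 * infnorm x - \<bar>x $ i + x $ j\<bar> - \<bar>x $ i - x $ j\<bar>)) =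
    (\<Sum>p\<in>{(i, j). {i, j} \<in> E}. (2 * infnorm x) * (case p of (i, j) \<Rightarrow> w i j)
      - (case p of (i, j) \<Rightarrow> w i j * \<bar>x $ i + x $ j\<bar>)
      - (case p of (i, j) \<Rightarrow> w i j * \<bar>x $ i - x $ j\<bar>))"
    by (intro sum.cong) (auto simp: algebra_simps)
  also have "\<dots> = 2 * infnorm x * vol E w UNIV - 2 * I_plus E w x - 2 * total_variation E w x"
    by (simp add: sum_subtractf flip: sum_distrib_left)
       (simp add: vol_eq_sum_edges I_plus_def total_variation_def)
  finally show ?thesis by simp
qed

lemma edge_defect_nonneg:
  fixes x :: "real ^ 'n"
  shows "2 * infnorm x - \<bar>x $ i + x $ j\<bar> - \<bar>x $ i - x $ j\<bar> \<ge> 0"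
  using component_le_infnorm_cart[of x i] component_le_infnorm_cart[of x j] by linarith

lemma edge_term_nonneg:
  fixes x :: "real ^ 'n"
  assumes "p \<in> {(i, j). {i, j} \<in> E}"
  shows "(case p of (i, j) \<Rightarrow> w i j * (2 * infnorm x - \<bar>x $ i + x $ j\<bar> - \<bar>x $ i - x $ j\<bar>)) \<ge> 0"
  using assms edge_defect_nonneg[of x] by (auto intro!: mult_nonneg_nonneg less_imp_le[OF weight_pos])

lemma total_variation_le:
  "total_variation E w x \<le> vol E w UNIV * infnorm x - I_plus E w x"
proof -
  have "0 \<le> vol E w UNIV * infnorm x - I_plus E w x - total_variation E w x"
    unfolding infnorm_minus_I_plus_minus_total_variation
    by (intro divide_nonneg_nonneg sum_nonneg edge_term_nonneg) auto
  then show ?thesis by simp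
qed

text \<open>On each edge one of the sum and the difference of the two entries has modulus 2 and the
  other vanishes, so every edge term is zero.\<close>

lemma total_variation_sign_vec:
  "total_variation E w (sign_vec A) = vol E w UNIV - I_plus E w (sign_vec A)"
proof -
  have "vol E w UNIV * infnorm (sign_vec A) - I_plus E w (sign_vec A)
      - total_variation E w (sign_vec A) = 0"
    unfolding infnorm_minus_I_plus_minus_total_variation unfolding infnorm_sign_vec
    by (auto intro!: sum.neutral)
  then show ?thesis unfolding infnorm_sign_vec by linarith
qed

text \<open>Nonnegative terms with zero sum all vanish, whereas an edge with both entries zero would
  leave the positive defect \<open>2 * infnorm x\<close>.\<close>

lemma vertex_cover_if_total_variation_eq:
  assumes "total_variation E w x = vol E w UNIV * infnorm x - I_plus E w x" "x \<noteq> 0"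
  shows "vertex_cover E {i. x $ i \<noteq> 0}"
  unfolding vertex_cover_def
proof
  fix e assume e: "e \<in> E"
  then have "card e = 2" using wg by (auto simp: weighted_graph_def)
  then obtain i j where ij: "e = {i, j}" by (auto simp: card_2_iff)
  have "(\<Sum>(i, j)\<in>{(i, j). {i, j} \<in> E}.
      w i j * (2 * infnorm x - \<bar>x $ i + x $ j\<bar> - \<bar>x $ i - x $ j\<bar>)) = 0"
    using infnorm_minus_I_plus_minus_total_variation[of x] assms(1) by simp
  then have "\<forall>p\<in>{(i, j). {i, j} \<in> E}.
      (case p of (i, j) \<Rightarrow> w i j * (2 * infnorm x - \<bar>x $ i + x $ j\<bar> - \<bar>x $ i - x $ j\<bar>)) = 0"
    by (subst (asm) sum_nonneg_eq_0_iff) (simp, erule edge_term_nonneg, assumption)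
  then have "w i j * (2 * infnorm x - \<bar>x $ i + x $ j\<bar> - \<bar>x $ i - x $ j\<bar>) = 0"
    using e ij by fastforce
  then have "2 * infnorm x - \<bar>x $ i + x $ j\<bar> - \<bar>x $ i - x $ j\<bar> = 0"
    using weight_pos[of i j] e ij by simp
  moreover have "infnorm x > 0" using assms(2) by (simp add: infnorm_pos_lt)
  ultimately have "x $ i \<noteq> 0 \<or> x $ j \<noteq> 0" by auto
  then show "\<exists>i\<in>e. i \<in> {i. x $ i \<noteq> 0}" using ij by auto
qed

section \<open>Positivity from connectedness\<close>

lemma total_variation_nonneg: "total_variation E w x \<ge> 0"
  unfolding total_variation_def
  by (intro divide_nonneg_nonneg sum_nonneg)
     (auto intro!: mult_nonneg_nonneg less_imp_le[OF weight_pos])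

text \<open>Vanishing variation makes \<open>x\<close> constant across each edge, hence along
  paths.\<close>

lemma total_variation_pos:
  assumes "connected_graph E" "nonconstant x"
  shows "total_variation E w x > 0"
proof (rule ccontr)
  assume "\<not> ?thesis"
  then have "total_variation E w x = 0" using total_variation_nonneg[of x] by linarith
  then have "\<forall>p\<in>{(i, j). {i, j} \<in> E}. (case p of (i, j) \<Rightarrow> w i j * \<bar>x $ i - x $ j\<bar>) = 0"
    unfolding total_variation_def
    by (subst (asm) divide_eq_0_iff, subst (asm) sum_nonneg_eq_0_iff)
       (auto intro!: mult_nonneg_nonneg less_imp_le[OF weight_pos])
  then have edge: "x $ i = x $ j" if "{i, j} \<in> E" for i j
    using that weight_pos[OF that] by fastforce
  have "x $ u = x $ v" for u v
  proof -
    have "(u, v) \<in> {(i, j). {i, j} \<in> E}\<^sup>*" using assms(1) by (auto simp: connected_graph_def)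
    then show ?thesis by (induction rule: rtrancl_induct) (auto simp: edge)
  qed
  then show False using assms(2) unfolding nonconstant_def by blast
qed

text \<open>A path from \<open>u\<close> to a different vertex starts with an edge at
  \<open>u\<close>.\<close>

lemma degree_pos:
  assumes "connected_graph E" "u \<noteq> v"
  shows "degree E w u > 0"
proof -
  have "(u, v) \<in> {(i, j). {i, j} \<in> E}\<^sup>*" using assms(1) by (auto simp: connected_graph_def)
  then obtain j where j: "{u, j} \<in> E" using assms(2) by (auto elim: converse_rtranclE)
  then show ?thesis unfolding degree_def
    by (intro sum_pos2[of _ j]) (auto intro: weight_pos less_imp_le)
qed

section \<open>Seminorm properties of \<open>N\<close>\<close>

lemma N_le: "N E w x \<le> (\<Sum>i\<in>UNIV. degree E w i * \<bar>x $ i - t\<bar>)"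
  using N_attained[OF wg, of x] by blast

lemma N_greatest:
  assumes "\<And>t. c \<le> (\<Sum>i\<in>UNIV. degree E w i * \<bar>x $ i - t\<bar>)"
  shows "c \<le> N E w x"
  using N_attained[OF wg, of x] assms by metis

lemma N_nonneg: "N E w x \<ge> 0"
  by (intro N_greatest sum_nonneg mult_nonneg_nonneg degree_nonneg) auto

lemma N_constant: "(\<And>i. x $ i = c) \<Longrightarrow> N E w x = 0"
  using N_le[of x c] N_nonneg[of x] by simp

text \<open>The sum of the optimal shifts for \<open>x\<close> and \<open>y\<close> is a competitor
  for \<open>x + y\<close>.\<close>

lemma N_triangle: "N E w (x + y) \<le> N E w x + N E w y"
proof -
  obtain s where s: "N E w x = (\<Sum>i\<in>UNIV. degree E w i * \<bar>x $ i - s\<bar>)"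
    using N_attained[OF wg] by blast
  obtain t where t: "N E w y = (\<Sum>i\<in>UNIV. degree E w i * \<bar>y $ i - t\<bar>)"
    using N_attained[OF wg] by blast
  have "N E w (x + y) \<le> (\<Sum>i\<in>UNIV. degree E w i * \<bar>(x + y) $ i - (s + t)\<bar>)" by (rule N_le)
  also have "\<dots> \<le> (\<Sum>i\<in>UNIV. degree E w i * (\<bar>x $ i - s\<bar> + \<bar>y $ i - t\<bar>))"
    by (intro sum_mono mult_left_mono degree_nonneg) auto
  also have "\<dots> = N E w x + N E w y" by (simp add: s t distrib_left sum.distrib)
  finally show ?thesis .
qed

lemma N_scaleR_le:
  assumes "c \<ge> 0"
  shows "N E w (c *\<^sub>R x) \<le> c * N E w x"
proof -
  obtain t where t: "N E w x = (\<Sum>i\<in>UNIV. degree E w i * \<bar>x $ i - t\<bar>)"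
    using N_attained[OF wg] by blast
  have "\<bar>c * a - c * t\<bar> = c * \<bar>a - t\<bar>" for a
    using assms by (simp add: abs_mult flip: right_diff_distrib)
  then have "(\<Sum>i\<in>UNIV. degree E w i * \<bar>(c *\<^sub>R x) $ i - c * t\<bar>) = c * N E w x"
    by (simp add: t sum_distrib_left mult.left_commute)
  then show ?thesis using N_le[of "c *\<^sub>R x" "c * t"] by simp
qed

lemma I_plus_scaleR:
  assumes "c \<ge> 0"
  shows "I_plus E w (c *\<^sub>R x) = c * I_plus E w x"
proof -
  have "\<bar>c * a + c * b\<bar> = c * \<bar>a + b\<bar>" for a b
    using assms by (simp add: abs_mult flip: distrib_left)
  then show ?thesis
    by (simp add: I_plus_def sum_distrib_left split_def mult.left_commute)
qed

text \<open>The inclusion is paired with \<open>x\<close>, and Euler's identity evaluates each of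
  the three inner products.\<close>

lemma eigenpair_eq:
  assumes "eigenpair E w l x"
  shows "vol E w UNIV * infnorm x = I_plus E w x + l * N E w x"
proof -
  obtain u v z where u: "u \<in> subdifferential infnorm x" and v: "v \<in> subdifferential (I_plus E w) x"
    and z: "z \<in> subdifferential (N E w) x" and eq: "0 = vol E w UNIV *\<^sub>R u - v - l *\<^sub>R z"
    using assms unfolding eigenpair_def Delta1_plus_def by blast
  have "u \<bullet> x = infnorm x"
    using u by (rule subdifferential_inner_eq) (auto simp: infnorm_0 infnorm_mul)
  moreover have "v \<bullet> x = I_plus E w x"
    using v
    by (rule subdifferential_inner_eq) (simp_all add: I_plus_scaleR, simp add: I_plus_def)
  moreover have "z \<bullet> x = N E w x"
    using z by (rule subdifferential_inner_eq) (auto intro: N_constant N_scaleR_le)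
  moreover have "vol E w UNIV * (u \<bullet> x) = v \<bullet> x + l * (z \<bullet> x)"
    using arg_cong[OF eq, of "\<lambda>y. y \<bullet> x"] by (simp add: inner_diff_left)
  ultimately show ?thesis by simp
qed

section \<open>Reduction to sign vectors by peeling level sets\<close>

text \<open>The top level set of \<open>y\<close> is lowered to the second largest value \<open>a\<close>, and then everything is
  shifted by half of the gap, which gives a vector with fewer values.\<close>

lemma N_le_total_variation_if_sign_vec:
  assumes "h \<ge> 0"
    and sign: "\<And>A. A \<noteq> {} \<Longrightarrow> A \<noteq> UNIV \<Longrightarrow>
      h * N E w (sign_vec A) \<le> total_variation E w (sign_vec A)"
  shows "h * N E w y \<le> total_variation E w y"
proof (induction "card (range (($) y))" arbitrary: y rule: less_induct)
  case less
  let ?R = "range (($) y)"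
  define b where "b = Max ?R"
  have b: "b \<in> ?R" "y $ i \<le> b" for i by (auto simp: b_def intro: Max_in)
  show ?case
  proof (cases "?R = {b}")
    case True
    then have "y $ i = b" for i by blast
    then have "N E w y = 0" by (rule N_constant)
    then show ?thesis using total_variation_nonneg[of y] by simp
  next
    case False
    define a where "a = Max (?R - {b})"
    have "?R - {b} \<noteq> {}" using False b(1) by blast
    then have a: "a \<in> ?R - {b}" unfolding a_def by (intro Max_in) auto
    have le_a: "y $ i \<noteq> b \<Longrightarrow> y $ i \<le> a" for i unfolding a_def by (intro Max_ge) auto
    define A where "A = {i. y $ i = b}"
    define c where "c = (b - a) / 2"
    define y' where "y' = (\<chi> i. if i \<in> A then a + c else y $ i + c)"
    obtain k where "a = y $ k" using a by blast
    then have ab: "a < b" using a b(2)[of k] by auto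
    have c: "c \<ge> 0" and b_eq: "b = a + 2 * c" using ab by (simp_all add: c_def field_simps)
    have A: "A \<noteq> {}" "A \<noteq> UNIV" using a b(1) by (auto simp: A_def)
    have y: "y = y' + c *\<^sub>R sign_vec A"
      by (auto simp: vec_eq_iff y'_def A_def c_def field_simps)
    \<comment> \<open>The value \<open>b\<close> is lost and no new level is created, so the
      induction hypothesis applies to \<open>y'\<close>.\<close>
    have "range (($) y') \<subseteq> (\<lambda>r. r + c) ` (?R - {b})"
    proof safe
      fix i
      show "y' $ i \<in> (\<lambda>r. r + c) ` (?R - {b})"
        using a by (cases "i \<in> A") (auto simp: y'_def A_def)
    qed
    then have "card (range (($) y')) \<le> card (?R - {b})"
      by (rule surj_card_le[rotated]) simp
    also have "\<dots> < card ?R" using b(1) by (intro card_Diff1_less) auto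
    finally have IH: "h * N E w y' \<le> total_variation E w y'" by (rule less)
    have "N E w y \<le> N E w y' + c * N E w (sign_vec A)"
      using N_triangle[of y' "c *\<^sub>R sign_vec A"] N_scaleR_le[OF c, of "sign_vec A"] y by simp
    then have "h * N E w y \<le> h * N E w y' + c * (h * N E w (sign_vec A))"
      using mult_left_mono[OF _ assms(1)] by (fastforce simp: algebra_simps)
    also have "\<dots> \<le> total_variation E w y' + c * total_variation E w (sign_vec A)"
      by (intro add_mono IH mult_left_mono sign A c)
    also have "\<dots> = total_variation E w y"
    proof -
      \<comment> \<open>On \<open>A\<close> the vector \<open>y'\<close> attains its maximum
        \<open>a + c\<close>, so \<open>y'\<close> and \<open>sign_vec A\<close> never order two
        vertices oppositely, and their absolute differences add without cancellation.\<close>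
      have "\<bar>y $ i - y $ j\<bar> = \<bar>y' $ i - y' $ j\<bar> + c * \<bar>sign_vec A $ i - sign_vec A $ j\<bar>" for i j
        using le_a[of i] le_a[of j] c b_eq by (auto simp: y'_def A_def)
      then have "total_variation E w y =
          (\<Sum>p\<in>{(i, j). {i, j} \<in> E}. (case p of (i, j) \<Rightarrow> w i j * \<bar>y' $ i - y' $ j\<bar>) +
            c * (case p of (i, j) \<Rightarrow> w i j * \<bar>sign_vec A $ i - sign_vec A $ j\<bar>)) / 2"
        unfolding total_variation_def
        by (intro arg_cong[where f = "\<lambda>s. s / 2"] sum.cong)
           (auto simp: distrib_left mult.left_commute simp del: sign_vec_nth)
      then show ?thesis
        by (simp add: total_variation_def sum.distrib add_divide_distrib
            del: sign_vec_nth flip: sum_distrib_left)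
    qed
    finally show ?thesis .
  qed
qed

section \<open>Explicit subgradients\<close>

lemma I_plus_subgradient: "subdifferential (I_plus E w) x \<noteq> {}"
proof -
  \<comment> \<open>Each edge contributes a subgradient of its absolute value;
    \<open>sgn 0 = 0\<close> is an admissible choice where the two entries cancel.\<close>
  define v where "v = (\<chi> i. \<Sum>j | {i, j} \<in> E. w i j * sgn (x $ i + x $ j))"
  have inner: "v \<bullet> y =
      (\<Sum>(i, j)\<in>{(i, j). {i, j} \<in> E}. w i j * (sgn (x $ i + x $ j) * (y $ i + y $ j))) / 2"
    for y
  proof -
    let ?P = "{(i, j). {i, j} \<in> E}"
    define g where "g i j = w i j * sgn (x $ i + x $ j) * y $ i" for i j
    have "v \<bullet> y = (\<Sum>(i, j)\<in>?P. g i j)"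
      by (simp add: sum_over_edges inner_vec_def v_def g_def sum_distrib_right)
    \<comment> \<open>Swapping the endpoints symmetrises the sum over ordered edges, which accounts
      for the division by 2.\<close>
    moreover have "(\<Sum>(i, j)\<in>?P. g i j) = (\<Sum>(i, j)\<in>?P. g j i)"
      by (rule sum.reindex_bij_witness[of _ prod.swap prod.swap]) (auto simp: insert_commute)
    moreover have "(\<Sum>(i, j)\<in>?P. w i j * (sgn (x $ i + x $ j) * (y $ i + y $ j))) =
        (\<Sum>p\<in>?P. (case p of (i, j) \<Rightarrow> g i j) + (case p of (i, j) \<Rightarrow> g j i))"
      by (intro sum.cong) (auto simp: g_def algebra_simps dest: weight_sym)
    ultimately show ?thesis by (simp add: sum.distrib)
  qed
  have "v \<bullet> y \<le> I_plus E w y" for y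
    unfolding inner I_plus_def
    by (intro divide_right_mono sum_mono)
       (auto intro!: mult_left_mono less_imp_le[OF weight_pos] simp: sgn_if)
  moreover have "v \<bullet> x = I_plus E w x"
  proof -
    have "sgn a * a = \<bar>a\<bar>" for a :: real by (simp add: sgn_if)
    then show ?thesis unfolding inner I_plus_def by simp
  qed
  ultimately have "v \<in> subdifferential (I_plus E w) x"
    by (auto simp: subdifferential_def inner_diff_right)
  then show ?thesis by blast
qed

text \<open>A vector \<open>z\<close> with zero sum and entries bounded by the degrees satisfies
  \<open>z \<bullet> y \<le> N E w y\<close> for all \<open>y\<close>, so it is a subgradient
  wherever equality holds. The proof exhibits such a \<open>z\<close> with equality at
  \<open>sign_vec A\<close>.\<close>

lemma N_sign_vec_subgradient:
  assumes "connected_graph E" "A \<noteq> {}" "A \<noteq> UNIV"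
  shows "subdifferential (N E w) (sign_vec A) \<noteq> {}" "N E w (sign_vec A) > 0"
proof -
  let ?d = "degree E w"
  define a b where "a = sum ?d A" and "b = sum ?d (- A)"
  define m where "m = min a b"
  obtain i j where ij: "i \<in> A" "j \<notin> A" using assms(2,3) by blast
  have "?d i > 0" "?d j > 0" using ij by (auto intro: degree_pos[OF assms(1)])
  then have pos: "a > 0" "b > 0"
    unfolding a_def b_def
    using ij by (auto intro: sum_pos2[of _ i] sum_pos2[of _ j] degree_nonneg)
  \<comment> \<open>On each side \<open>z\<close> is proportional to the degree, with total
    \<open>m\<close> on \<open>A\<close> and \<open>- m\<close> off \<open>A\<close>. Taking the
    smaller volume for \<open>m\<close> keeps both factors at most 1 in modulus.\<close>
  define z where "z = (\<chi> i. ?d i * (if i \<in> A then m / a else - (m / b)))"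
  have split: "(\<Sum>i\<in>UNIV. f i) = sum f A + sum f (- A)" for f :: "'n \<Rightarrow> real"
    using sum.union_disjoint[of A "- A" f] by simp
  have sumA: "(\<Sum>i\<in>A. ?d i * c) = a * c" and sumB: "(\<Sum>i\<in>- A. ?d i * c) = b * c" for c
    by (simp_all add: a_def b_def sum_distrib_right)
  have "(\<Sum>i\<in>A. z $ i) = (\<Sum>i\<in>A. ?d i * (m / a))" by (intro sum.cong) (auto simp: z_def)
  then have zA: "(\<Sum>i\<in>A. z $ i) = m" unfolding sumA using pos by simp
  have "(\<Sum>i\<in>- A. z $ i) = (\<Sum>i\<in>- A. ?d i * (- (m / b)))"
    by (intro sum.cong) (auto simp: z_def)
  then have zB: "(\<Sum>i\<in>- A. z $ i) = - m" unfolding sumB using pos by simp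
  have sum0: "(\<Sum>i\<in>UNIV. z $ i) = 0" unfolding split zA zB by simp
  have z_le: "\<bar>z $ i\<bar> \<le> ?d i" for i
  proof -
    have "\<bar>if i \<in> A then m / a else - (m / b)\<bar> \<le> 1" using pos by (auto simp: m_def)
    then show ?thesis
      unfolding z_def using mult_left_mono[OF _ degree_nonneg[of i]]
      by (fastforce simp: abs_mult degree_nonneg)
  qed
  have le: "z \<bullet> y \<le> N E w y" for y
  proof (rule N_greatest)
    fix t
    have "z \<bullet> y = (\<Sum>i\<in>UNIV. z $ i * (y $ i - t))"
      using sum0 by (simp add: inner_vec_def right_diff_distrib sum_subtractf flip: sum_distrib_right)
    also have "\<dots> \<le> (\<Sum>i\<in>UNIV. ?d i * \<bar>y $ i - t\<bar>)"
    proof (intro sum_mono)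
      fix i
      have "z $ i * (y $ i - t) \<le> \<bar>z $ i\<bar> * \<bar>y $ i - t\<bar>" by (metis abs_ge_self abs_mult)
      also have "\<dots> \<le> ?d i * \<bar>y $ i - t\<bar>" by (intro mult_right_mono z_le) auto
      finally show "z $ i * (y $ i - t) \<le> ?d i * \<bar>y $ i - t\<bar>" .
    qed
    finally show "z \<bullet> y \<le> (\<Sum>i\<in>UNIV. ?d i * \<bar>y $ i - t\<bar>)" .
  qed
  have zs: "z \<bullet> sign_vec A = 2 * m"
    unfolding inner_vec_def split using zA zB by (simp add: sum_negf)
  \<comment> \<open>The shifts -1 and 1 kill the terms outside and inside \<open>A\<close>, leaving
    \<open>2 * a\<close> and \<open>2 * b\<close>.\<close>
  moreover have "N E w (sign_vec A) \<le> 2 * m"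
    using N_le[of "sign_vec A" "-1"] N_le[of "sign_vec A" 1]
    by (simp add: split sumA sumB m_def)
  ultimately have eq: "N E w (sign_vec A) = z \<bullet> sign_vec A"
    using le[of "sign_vec A"] by linarith
  have "z \<in> subdifferential (N E w) (sign_vec A)"
    using le eq by (auto simp: subdifferential_def inner_diff_right)
  then show "subdifferential (N E w) (sign_vec A) \<noteq> {}" by blast
  show "N E w (sign_vec A) > 0" using eq zs pos by (simp add: m_def)
qed

section \<open>The minimising sign vector as an eigenvector\<close>

lemma eigenpair_sign_vec:
  fixes A :: "'n set"
  assumes "connected_graph E" "A \<noteq> {}" "A \<noteq> UNIV" "h \<ge> 0"
    and le: "\<And>y. h * N E w y \<le> total_variation E w y"
    and eq: "h * N E w (sign_vec A) = total_variation E w (sign_vec A)"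
  shows "eigenpair E w h (sign_vec A)"
proof -
  let ?s = "sign_vec A"
  have vol_pos: "vol E w UNIV > 0"
  proof -
    obtain i j where "i \<in> A" "j \<notin> A" using assms(2,3) by blast
    then have "i \<noteq> j" by auto
    then show ?thesis
      unfolding vol_def by (intro sum_pos2[of _ i]) (auto intro: degree_pos assms degree_nonneg)
  qed
  obtain v where v: "v \<in> subdifferential (I_plus E w) ?s" using I_plus_subgradient by blast
  obtain z where z: "z \<in> subdifferential (N E w) ?s"
    using N_sign_vec_subgradient[OF assms(1-3)] by blast
  \<comment> \<open>The eigenvalue equation forces this \<open>u\<close>; what remains is that it is
    a subgradient of \<open>infnorm\<close>.\<close>
  define u where "u = (1 / vol E w UNIV) *\<^sub>R (v + h *\<^sub>R z)"
  have u_inner: "vol E w UNIV * (u \<bullet> y) = v \<bullet> y + h * (z \<bullet> y)" for y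
    using vol_pos by (simp add: u_def inner_add_left)
  have "u \<in> subdifferential infnorm ?s"
    unfolding subdifferential_def
  proof safe
    fix y
    \<comment> \<open>The function \<open>I_plus + h * N\<close> lies below
      \<open>vol * infnorm\<close> and touches it at \<open>?s\<close>, so its subgradients there
      are subgradients of the upper function too.\<close>
    have "vol E w UNIV * (infnorm ?s + u \<bullet> (y - ?s)) =
        I_plus E w ?s + v \<bullet> (y - ?s) + h * (N E w ?s + z \<bullet> (y - ?s))"
      using total_variation_sign_vec[of A] eq u_inner[of "y - ?s"]
      by (simp add: infnorm_sign_vec distrib_left)
    also have "\<dots> \<le> I_plus E w y + h * N E w y"
      using v z by (intro add_mono mult_left_mono assms(4)) (auto simp: subdifferential_def)
    also have "\<dots> \<le> vol E w UNIV * infnorm y"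
      using le[of y] total_variation_le[of y] by linarith
    finally show "infnorm y \<ge> infnorm ?s + u \<bullet> (y - ?s)" using vol_pos by simp
  qed
  moreover have "0 = vol E w UNIV *\<^sub>R u - v - h *\<^sub>R z" using vol_pos by (simp add: u_def)
  moreover have "?s \<noteq> 0" by (auto simp: vec_eq_iff)
  ultimately show ?thesis using v z unfolding eigenpair_def Delta1_plus_def by blast
qed

text \<open>The least quotient over sign vectors exists because there are finitely many vertex sets.
  Connectedness makes it positive, hence a nonzero eigenvalue.\<close>

lemma eigenvalue_le_total_variation:
  fixes x :: "real ^ 'n"
  assumes "connected_graph E" "nonconstant x"
  obtains h where "h \<in> nonzero_nonconst_eigenvalues E w"
    and "\<And>y. h * N E w y \<le> total_variation E w y"
proof -
  let ?S = "{A :: 'n set. A \<noteq> {} \<and> A \<noteq> UNIV}"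
  let ?q = "\<lambda>A. total_variation E w (sign_vec A) / N E w (sign_vec A)"
  obtain i j :: 'n where "x $ i \<noteq> x $ j" using assms(2) unfolding nonconstant_def by metis
  then have "i \<noteq> j" by auto
  \<comment> \<open>Two distinct vertices make the singleton a proper subset, so the minimum is over
    a nonempty family.\<close>
  then have "{i} \<in> ?S" by auto
  then have "?S \<noteq> {}" by blast
  then have "Min (?q ` ?S) \<in> ?q ` ?S" by (intro Min_in) auto
  then obtain A where A: "A \<in> ?S" and q: "Min (?q ` ?S) = ?q A" by (rule imageE)
  have min: "?q A \<le> ?q B" if "B \<in> ?S" for B
    unfolding q[symmetric] using that by (intro Min_le) auto
  have TV_pos: "total_variation E w (sign_vec B) > 0" and N_pos: "N E w (sign_vec B) > 0"
    if "B \<in> ?S" for B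
    using that by (auto intro: total_variation_pos nonconstant_sign_vec N_sign_vec_subgradient assms)
  have q_pos: "?q A > 0" using TV_pos[OF A] N_pos[OF A] by simp
  have le: "?q A * N E w y \<le> total_variation E w y" for y
  proof (rule N_le_total_variation_if_sign_vec)
    show "?q A \<ge> 0" using q_pos by simp
    fix B :: "'n set" assume "B \<noteq> {}" "B \<noteq> UNIV"
    then have "B \<in> ?S" by blast
    then show "?q A * N E w (sign_vec B) \<le> total_variation E w (sign_vec B)"
      using min N_pos by (simp add: pos_le_divide_eq)
  qed
  have "eigenpair E w (?q A) (sign_vec A)"
    using A N_pos[OF A] q_pos by (intro eigenpair_sign_vec assms(1) le) auto
  moreover have "nonconstant (sign_vec A)" using A by (auto intro: nonconstant_sign_vec)
  ultimately have "?q A \<in> nonzero_nonconst_eigenvalues E w"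
    using less_imp_neq[OF q_pos, symmetric] unfolding nonzero_nonconst_eigenvalues_def by blast
  then show thesis using le by (rule that)
qed

end

theorem theorem2p4:
  fixes E :: "'n::finite set set" and w :: "'n \<Rightarrow> 'n \<Rightarrow> real"
    and \<mu> :: real and x :: "real ^ 'n"
  assumes "weighted_graph E w"
    and "connected_graph E"
    and "\<mu> \<in> nonzero_nonconst_eigenvalues E w"
    and "\<forall>l \<in> nonzero_nonconst_eigenvalues E w. \<mu> \<le> l"
    and "eigenpair E w \<mu> x"
    and "nonconstant x"
  shows "vertex_cover E {i. x $ i \<noteq> 0}"
proof -
  obtain h where h: "h \<in> nonzero_nonconst_eigenvalues E w"
    and le: "\<And>y. h * N E w y \<le> total_variation E w y"
    using eigenvalue_le_total_variation[OF assms(1,2,6)] by blast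
  have "\<mu> * N E w x \<le> h * N E w x"
    using assms(4) h by (intro mult_right_mono N_nonneg assms(1)) auto
  \<comment> \<open>The chain from \<open>\<mu> * N\<close> through \<open>h * N\<close> and the
    total variation up to \<open>vol * infnorm - I_plus\<close> ends at its starting value, so it
    collapses to equalities.\<close>
  then have "total_variation E w x = vol E w UNIV * infnorm x - I_plus E w x"
    using le[of x] total_variation_le[OF assms(1), of x] eigenpair_eq[OF assms(1,5)] by linarith
  moreover have "x \<noteq> 0" using assms(5) by (simp add: eigenpair_def)
  ultimately show ?thesis by (rule vertex_cover_if_total_variation_eq[OF assms(1)])
qed

end
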